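(* For every $\epsilon > 0$ there is a constant $C_\epsilon > 0$ such that the following holds. Let $N \geq 3$ be real and let $\alpha$ be a real number such that $|\alpha - \frac{a}{q}| \leq \frac{1}{q N^{5/4}}$ for some integers $a$ and $q$ with $1 \leq q \leq N^{5/4}$ and $(a,q)=1$. Then there exist integers $a_1, a_2$ and prime numbers $q_1 < q_2 \leq N$ such that $$\Big|\alpha - \frac{a_1}{q_1} - \frac{a_2}{q_2}\Big| \leq \frac{C_\epsilon}{q N^{5/4 - \epsilon}}.$$ *)

theory Defs
  imports Complex_Main "HOL-Computational_Algebra.Primes"
begin

end

theory Submission
  imports Defs "HOL-Analysis.Analysis" "HOL-Real_Asymp.Real_Asymp"
begin

text \<open>For distinct primes \<open>p\<close>, \<open>p'\<close> every integer has the form \<open>a\<^sub>1 p' + a\<^sub>2 p\<close>, so it is enough to find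
  such primes of size \<open>N\<^bsup>1-o(1)\<^esup>\<close> with \<open>a p p' / q\<close> within \<open>\<delta> = N\<^bsup>3/4+o(1)\<^esup> / q\<close> of an integer. Detecting this
  with a power of the Fejer kernel of length \<open>L = N\<^bsup>o(1)\<^esup> / \<delta>\<close>, one needs the exponential sums
  \<open>\<Sum>\<^bsub>p,p'\<^esub> e (a h p p' / q)\<close> to be small on average over \<open>1 \<le> h \<le> L\<close>. Merging \<open>n = h p\<close> into one
  variable of length \<open>L N\<close>, Cauchy-Schwarz and orthogonality modulo \<open>q\<close> bound their total by
  the square root of \<open>L (L N + q) (N / q + 1) N\<^sup>2\<close>, which is \<open>o (N\<^sup>2)\<close> for \<open>q \<le> N\<^bsup>5/4\<^esup>\<close>. The supply of
  primes comes from Chebyshev's lower bound.\<close>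

section \<open>Chebyshev's lower bound\<close>

text \<open>The reciprocals of the numbers \<open>m * ((m + n) choose n)\<close> form Leibniz's harmonic triangle: each is a
  difference of two neighbouring reciprocals of the preceding row, so all of them are integer
  combinations of \<open>1 / i\<close> with \<open>i \<le> m + n\<close>.\<close>

lemma mult_binomial_dvd:
  fixes D T :: nat
  assumes D: "\<And>i. 1 \<le> i \<Longrightarrow> i \<le> T \<Longrightarrow> i dvd D"
  shows "1 \<le> m \<Longrightarrow> m + n \<le> T \<Longrightarrow> m * ((m + n) choose n) dvd D"
proof (induction n arbitrary: m)
  case 0
  then show ?case using D by simp
next
  case (Suc n)
  define c where "c = (m + n) choose n"
  define z where "z = m * ((m + Suc n) choose Suc n)"
  have sym: "(Suc m + n) choose n = (Suc m + n) choose Suc m"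
    using binomial_symmetric[of n "Suc m + n"] by simp
  have c_sym: "c = (m + n) choose m"
    unfolding c_def using binomial_symmetric[of n "m + n"] by simp
  have y: "Suc m * ((Suc m + n) choose n) = (m + n + 1) * c"
    unfolding sym c_sym using Suc_times_binomial_eq[of "m + n" m] by (simp add: mult.commute)
  have z: "(n + 1) * z = m * ((m + n + 1) * c)"
    unfolding z_def c_def using Suc_times_binomial_eq[of "m + n" n] by (simp add: mult.commute mult.left_commute)
  have "m * c dvd D" unfolding c_def using Suc by simp
  then obtain u where u: "D = m * c * u" by blast
  have "Suc m * ((Suc m + n) choose n) dvd D" using Suc.IH[of "Suc m"] Suc.prems by simp
  then obtain v where v: "D = (m + n + 1) * c * v" unfolding y by blast
  \<comment> \<open>With \<open>u = D / (m * c)\<close> and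
    \<open>v = D / ((m + n + 1) * c)\<close>, the triangle rule
    \<open>1 / (m * c) - 1 / ((m + n + 1) * c) = 1 / z\<close> says that \<open>u - v\<close> is the
    cofactor of \<open>z\<close> in \<open>D\<close>. The computation moves to \<open>int\<close> so
    that this difference is a true subtraction.\<close>
  have z': "(int n + 1) * int z = int m * ((int m + int n + 1) * int c)"
    using arg_cong[OF z, of int] by (simp add: algebra_simps)
  have u': "int D = int m * int c * int u" using arg_cong[OF u, of int] by simp
  have v': "int D = (int m + int n + 1) * int c * int v" using arg_cong[OF v, of int] by (simp add: algebra_simps)
  have "(int n + 1) * (int z * (int u - int v)) = (int m * ((int m + int n + 1) * int c)) * (int u - int v)"
    using z' by (metis mult.assoc)
  also have "\<dots> = (int m + int n + 1) * (int m * int c * int u) - int m * ((int m + int n + 1) * int c * int v)"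
    by (simp add: algebra_simps)
  also have "\<dots> = (int m + int n + 1) * int D - int m * int D" by (simp only: u'[symmetric] v'[symmetric])
  also have "\<dots> = (int n + 1) * int D" by (simp add: algebra_simps)
  finally have "int z * (int u - int v) = int D" by simp
  hence "int z dvd int D" by (metis dvd_triv_left)
  hence "z dvd D" by (simp only: int_dvd_int_iff)
  thus ?case by (simp only: z_def)
qed

text \<open>The number \<open>D\<close> in the proof is the least common multiple of 1, ...,
  \<open>2 * n\<close>. It is a product of one prime power per prime, each at most
  \<open>2 * n\<close>, which gives the right-hand side. It is also divisible by
  \<open>n * ((2 * n) choose n)\<close>, and the factor \<open>n\<close> cancels the
  \<open>n\<close> lost in the bound \<open>4 ^ n / (2 * n)\<close> for the central binomial
  coefficient.\<close>

lemma central_binomial_le_prime_count: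
  fixes n :: nat
  assumes n: "n \<ge> 1"
  shows "4 ^ n / 2 \<le> (real (2 * n)) ^ card {p. prime p \<and> p \<le> 2 * n}"
proof -
  define T where "T = 2 * n"
  define P where "P = {p::nat. prime p \<and> p \<le> T}"
  \<comment> \<open>The largest exponent with \<open>p ^ e p \<le> T\<close>, as \<open>le_e\<close>
    and \<open>e_le\<close> confirm.\<close>
  define e where "e p = nat \<lfloor>log (real p) (real T)\<rfloor>" for p
  define D where "D = (\<Prod>p\<in>P. p ^ e p)"
  have fin: "finite P" unfolding P_def by (rule finite_subset[of _ "{..T}"]) auto
  have T: "T \<ge> 2" using n T_def by simp
  have le_e: "k \<le> e p" if "prime p" "p ^ k \<le> T" for p k
  proof -
    have p: "real p > 1" using prime_gt_1_nat[OF that(1)] by simp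
    have "real p powr real k \<le> real T" using that p by (simp add: powr_realpow flip: of_nat_power)
    hence "real k \<le> log (real p) (real T)" using p T by (simp add: le_log_iff)
    thus ?thesis unfolding e_def by (simp add: le_nat_iff le_floor_iff)
  qed
  have e_le: "p ^ e p \<le> T" if "prime p" "p \<le> T" for p
  proof -
    have p: "real p > 1" using prime_gt_1_nat[OF that(1)] by simp
    have "real (e p) \<le> log (real p) (real T)"
      unfolding e_def using p T by (simp add: of_nat_nat)
    hence "real p powr real (e p) \<le> real T" using p T by (simp add: le_log_iff)
    thus ?thesis using p by (simp add: powr_realpow flip: of_nat_power)
  qed
  have dvd: "i dvd D" if i: "1 \<le> i" "i \<le> T" for i
  proof -
    have "(\<Prod>p\<in>prime_factors i. p ^ multiplicity p i) dvd D"
      unfolding D_def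
    proof (rule prod_dvd_prod_subset2[OF fin])
      show "prime_factors i \<subseteq> P"
        using i by (auto simp: P_def prime_factors_dvd dest: dvd_imp_le)
      fix p assume p: "p \<in> prime_factors i"
      have "p ^ multiplicity p i \<le> i" using i by (intro dvd_imp_le multiplicity_dvd) auto
      thus "p ^ multiplicity p i dvd p ^ e p"
        using p i by (intro le_imp_power_dvd le_e) auto
    qed
    thus ?thesis using i by (subst (asm) prod_prime_factors) auto
  qed
  have "n * ((n + n) choose n) dvd D"
    by (rule mult_binomial_dvd[of T]) (use dvd n T_def in auto)
  moreover have "D > 0" unfolding D_def by (intro prod_pos) (auto simp: P_def prime_gt_0_nat)
  ultimately have "n * ((2 * n) choose n) \<le> D" by (simp add: dvd_imp_le flip: mult_2)
  also have "D \<le> T ^ card P"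
    unfolding D_def using prod_mono[of P "\<lambda>p. p ^ e p" "\<lambda>_. T"] e_le by (auto simp: P_def)
  finally have *: "n * ((2 * n) choose n) \<le> T ^ card P" .
  have "4 ^ n / (2 * real n) \<le> real ((2 * n) choose n)"
    using central_binomial_lower_bound[of n] n by simp
  hence "4 ^ n / 2 \<le> real (n * ((2 * n) choose n))" using n by (simp add: field_simps)
  also have "\<dots> \<le> real (T ^ card P)" using * by (simp only: of_nat_le_iff)
  finally show ?thesis unfolding T_def P_def by simp
qed

text \<open>Take logarithms in the preceding bound with \<open>2 * n\<close> the largest even
  integer up to \<open>N\<close>. Of the 3 subtracted from \<open>N\<close>, rounding accounts for 2
  and the factor \<open>1 / 2\<close> for 1.\<close>

lemma prime_count_lower_bound:
  fixes N :: real
  assumes N: "N \<ge> 3"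
  shows "(N - 3) * ln 2 \<le> real (card {p::nat. prime p \<and> real p \<le> N}) * ln N"
proof -
  define n where "n = nat \<lfloor>N / 2\<rfloor>"
  have n1: "n \<ge> 1" unfolding n_def using N by linarith
  have n2: "2 * real n \<le> N" "N - 2 \<le> 2 * real n" unfolding n_def using N by linarith+
  let ?c = "card {p. prime p \<and> p \<le> 2 * n}"
  have fin: "finite {p::nat. prime p \<and> real p \<le> N}"
    by (rule finite_subset[of _ "{..nat \<lfloor>N\<rfloor>}"]) (use N in \<open>auto simp: le_nat_floor\<close>)
  have cc: "?c \<le> card {p::nat. prime p \<and> real p \<le> N}"
  proof (rule card_mono[OF fin])
    have "real p \<le> N" if "p \<le> 2 * n" for p
    proof -
      have "real p \<le> real (2 * n)" using that by (simp only: of_nat_le_iff)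
      thus ?thesis using n2 by simp
    qed
    thus "{p. prime p \<and> p \<le> 2 * n} \<subseteq> {p. prime p \<and> real p \<le> N}" by auto
  qed
  have "(2 * real n - 1) * ln 2 = ln (4 ^ n / 2 :: real)"
  proof -
    have "ln (4 ^ n / 2 :: real) = real n * ln (2 ^ 2) - ln 2"
      by (subst ln_div) (auto simp: ln_realpow)
    also have "\<dots> = (2 * real n - 1) * ln 2"
      by (subst ln_realpow) (auto simp: algebra_simps)
    finally show ?thesis by simp
  qed
  also have "\<dots> \<le> ln (real (2 * n) ^ ?c)"
    using central_binomial_le_prime_count[OF n1] by (subst ln_le_cancel_iff) (use n1 in auto)
  also have "\<dots> = real ?c * ln (2 * real n)" using n1 by (subst ln_realpow) auto
  also have "\<dots> \<le> real (card {p::nat. prime p \<and> real p \<le> N}) * ln N"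
    using cc n1 n2 N by (intro mult_mono) auto
  finally have "(2 * real n - 1) * ln 2 \<le> real (card {p::nat. prime p \<and> real p \<le> N}) * ln N" .
  moreover have "(N - 3) * ln 2 \<le> (2 * real n - 1) * ln (2::real)"
    using n2 by (intro mult_right_mono) auto
  ultimately show ?thesis by linarith
qed

section \<open>Powers of the Fejer kernel\<close>

text \<open>Each distance \<open>h\<close> from \<open>j\<close> is attained at most once to the
  left of \<open>j\<close> and at most once to the right.\<close>

lemma sum_shifted_le:
  fixes \<sigma> :: "nat \<Rightarrow> real"
  assumes \<sigma>: "\<And>h. \<sigma> h \<ge> 0" and j: "j \<le> L"
  shows "(\<Sum>l\<in>{..L} - {j}. \<sigma> (if l < j then j - l else l - j)) \<le> 2 * (\<Sum>h=1..L. \<sigma> h)"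
proof -
  have split: "{..L} - {j} = {..<j} \<union> {j<..L}" using j by auto
  have "(\<Sum>l\<in>{..<j}. \<sigma> (if l < j then j - l else l - j)) = (\<Sum>h\<in>(\<lambda>l. j - l) ` {..<j}. \<sigma> h)"
    by (subst sum.reindex) (auto simp: inj_on_def)
  also have "\<dots> \<le> (\<Sum>h=1..L. \<sigma> h)" using j by (intro sum_mono2) (auto simp: \<sigma>)
  finally have 1: "(\<Sum>l\<in>{..<j}. \<sigma> (if l < j then j - l else l - j)) \<le> (\<Sum>h=1..L. \<sigma> h)" .
  have "(\<Sum>l\<in>{j<..L}. \<sigma> (if l < j then j - l else l - j)) = (\<Sum>h\<in>(\<lambda>l. l - j) ` {j<..L}. \<sigma> h)"
    by (subst sum.reindex) (auto simp: inj_on_def intro!: sum.cong)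
  also have "\<dots> \<le> (\<Sum>h=1..L. \<sigma> h)" using j by (intro sum_mono2) (auto simp: \<sigma>)
  finally have 2: "(\<Sum>l\<in>{j<..L}. \<sigma> (if l < j then j - l else l - j)) \<le> (\<Sum>h=1..L. \<sigma> h)" .
  show ?thesis unfolding split using 1 2 by (subst sum.union_disjoint) auto
qed

lemma unit_power_mult_cnj:
  fixes w :: complex
  assumes "norm w = 1"
  shows "w ^ m * cnj (w ^ m) = 1"
proof -
  have "w * cnj w = 1" using complex_norm_square[of w] assms by simp
  thus ?thesis by (metis complex_cnj_power power_mult_distrib power_one)
qed

text \<open>On the unit circle conjugation inverts, so every summand is a power of
  \<open>z i\<close> for \<open>l < j\<close> and the conjugate of a power otherwise. Conjugating
  the whole sum keeps its modulus.\<close>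

lemma norm_sum_unit_powers:
  fixes z :: "'i \<Rightarrow> complex"
  assumes z: "\<And>i. i \<in> I \<Longrightarrow> norm (z i) = 1"
  shows "norm (\<Sum>i\<in>I. z i ^ j * cnj (z i ^ l)) = norm (\<Sum>i\<in>I. z i ^ (if l < j then j - l else l - j))"
proof -
  have u: "z i ^ m * cnj (z i ^ m) = 1" if "i \<in> I" for i m
    by (rule unit_power_mult_cnj) (rule z[OF that])
  show ?thesis
  proof (cases "l < j")
    case True
    have "z i ^ j * cnj (z i ^ l) = z i ^ (j - l)" if "i \<in> I" for i
    proof -
      have "z i ^ j = z i ^ (j - l) * z i ^ l" using True by (simp flip: power_add)
      thus ?thesis using u[OF that, of l] by (simp add: mult.assoc)
    qed
    thus ?thesis using True by simp
  next
    case False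
    have "z i ^ j * cnj (z i ^ l) = cnj (z i ^ (l - j))" if "i \<in> I" for i
    proof -
      have E: "z i ^ l = z i ^ (l - j) * z i ^ j" using False by (simp flip: power_add)
      have "z i ^ j * cnj (z i ^ l) = (z i ^ j * cnj (z i ^ j)) * cnj (z i ^ (l - j))"
        unfolding E complex_cnj_mult by (simp only: mult_ac)
      thus ?thesis by (simp only: u[OF that, of j] mult_1_left)
    qed
    hence "(\<Sum>i\<in>I. z i ^ j * cnj (z i ^ l)) = cnj (\<Sum>i\<in>I. z i ^ (l - j))" by simp
    thus ?thesis using False by (simp only: complex_mod_cnj if_False)
  qed
qed

text \<open>A diagonal dominance argument. Opening the square gives a quadratic form in
  \<open>b\<close> whose diagonal entries are \<open>card I\<close> and whose off-diagonal entries
  are at least minus the modulus of a power sum. Its value is then at least the smallest row sum of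
  these lower bounds times the sum of the squares of \<open>b\<close>.\<close>

lemma sum_norm_square_trig_ge:
  fixes z :: "'i \<Rightarrow> complex" and b :: "nat \<Rightarrow> real"
  assumes z: "\<And>i. i \<in> I \<Longrightarrow> norm (z i) = 1"
  assumes b: "\<And>j. b j \<ge> 0"
  shows "(\<Sum>j\<le>L. (b j)\<^sup>2) * (real (card I) - 2 * (\<Sum>h=1..L. norm (\<Sum>i\<in>I. z i ^ h)))
    \<le> (\<Sum>i\<in>I. (norm (\<Sum>j\<le>L. of_real (b j) * z i ^ j))\<^sup>2)"
proof -
  define \<sigma> where "\<sigma> h = norm (\<Sum>i\<in>I. z i ^ h)" for h
  define g where "g j l = (if j = l then real (card I) else - \<sigma> (if l < j then j - l else l - j))" for j l :: nat
  define R where "R j l = Re (\<Sum>i\<in>I. z i ^ j * cnj (z i ^ l))" for j l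
  have gR: "g j l \<le> R j l" for j l
  proof (cases "j = l")
    case True
    have "z i ^ j * cnj (z i ^ j) = 1" if "i \<in> I" for i
      by (rule unit_power_mult_cnj) (rule z[OF that])
    thus ?thesis using True by (simp add: g_def R_def)
  next
    case False
    have "- norm (\<Sum>i\<in>I. z i ^ j * cnj (z i ^ l)) \<le> R j l"
      unfolding R_def using abs_Re_le_cmod[of "\<Sum>i\<in>I. z i ^ j * cnj (z i ^ l)"] by linarith
    thus ?thesis using False norm_sum_unit_powers[of I z j l] z by (simp add: g_def \<sigma>_def)
  qed
  \<comment> \<open>Off the diagonal \<open>g j l \<le> 0\<close>, so replacing
    \<open>b j * b l\<close> by the larger mean of the two squares only decreases the term.\<close>
  have diag: "((b j)\<^sup>2 + (b l)\<^sup>2) / 2 * g j l \<le> b j * b l * R j l" for j l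
  proof (cases "j = l")
    case True
    thus ?thesis using mult_left_mono[OF gR[of j l], of "b j * b j"] b by (simp add: power2_eq_square)
  next
    case False
    have "b j * b l \<le> ((b j)\<^sup>2 + (b l)\<^sup>2) / 2"
      using zero_le_power2[of "b j - b l"] by (simp add: power2_diff)
    moreover have "g j l \<le> 0" using False by (simp add: g_def \<sigma>_def)
    ultimately have "((b j)\<^sup>2 + (b l)\<^sup>2) / 2 * g j l \<le> b j * b l * g j l"
      by (rule mult_right_mono_neg)
    also have "\<dots> \<le> b j * b l * R j l" using b gR by (intro mult_left_mono) auto
    finally show ?thesis .
  qed
  have gsym: "g j l = g l j" for j l unfolding g_def by auto
  have grow: "real (card I) - 2 * (\<Sum>h=1..L. \<sigma> h) \<le> (\<Sum>l\<le>L. g j l)" if j: "j \<le> L" for j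
  proof -
    have "(\<Sum>l\<le>L. g j l) = g j j + (\<Sum>l\<in>{..L}-{j}. g j l)"
      using j by (subst sum.remove[of _ j]) auto
    also have "(\<Sum>l\<in>{..L}-{j}. g j l) = - (\<Sum>l\<in>{..L}-{j}. \<sigma> (if l < j then j - l else l - j))"
      unfolding g_def by (subst sum_negf[symmetric]) (auto intro!: sum.cong)
    finally show ?thesis using sum_shifted_le[of \<sigma> j L] j by (simp add: g_def \<sigma>_def)
  qed
  have sq: "(norm (\<Sum>j\<le>L. of_real (b j) * w ^ j))\<^sup>2
      = (\<Sum>j\<le>L. \<Sum>l\<le>L. b j * b l * Re (w ^ j * cnj (w ^ l)))" for w :: complex
  proof -
    let ?s = "\<Sum>j\<le>L. of_real (b j) * w ^ j"
    have re: "Re (of_real r * u) = r * Re u" for r u by simp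
    have "(norm ?s)\<^sup>2 = Re (?s * cnj ?s)"
      using arg_cong[OF complex_norm_square[of ?s], of Re] by (simp only: Re_complex_of_real)
    also have "?s * cnj ?s = (\<Sum>j\<le>L. \<Sum>l\<le>L. of_real (b j * b l) * (w ^ j * cnj (w ^ l)))"
      by (simp add: sum_product mult_ac)
    also have "Re \<dots> = (\<Sum>j\<le>L. \<Sum>l\<le>L. b j * b l * Re (w ^ j * cnj (w ^ l)))"
      by (simp only: Re_sum re)
    finally show ?thesis .
  qed
  have "(\<Sum>j\<le>L. (b j)\<^sup>2) * (real (card I) - 2 * (\<Sum>h=1..L. \<sigma> h)) \<le> (\<Sum>j\<le>L. (b j)\<^sup>2 * (\<Sum>l\<le>L. g j l))"
    unfolding sum_distrib_right by (intro sum_mono mult_left_mono grow) auto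
  also have "\<dots> = (\<Sum>j\<le>L. \<Sum>l\<le>L. (b j)\<^sup>2 * g j l)" by (simp add: sum_distrib_left)
  \<comment> \<open>Since \<open>g\<close> is symmetric, the weight may be averaged over
    \<open>j\<close> and \<open>l\<close>.\<close>
  also have "\<dots> = (\<Sum>j\<le>L. \<Sum>l\<le>L. ((b j)\<^sup>2 + (b l)\<^sup>2) / 2 * g j l)"
  proof -
    have "(\<Sum>j\<le>L. \<Sum>l\<le>L. (b j)\<^sup>2 * g j l) = (\<Sum>j\<le>L. \<Sum>l\<le>L. (b l)\<^sup>2 * g j l)"
      by (subst sum.swap) (simp add: gsym)
    moreover have "(\<Sum>j\<le>L. \<Sum>l\<le>L. ((b j)\<^sup>2 + (b l)\<^sup>2) / 2 * g j l)
       = ((\<Sum>j\<le>L. \<Sum>l\<le>L. (b j)\<^sup>2 * g j l) + (\<Sum>j\<le>L. \<Sum>l\<le>L. (b l)\<^sup>2 * g j l)) / 2"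
      unfolding sum.distrib[symmetric] sum_divide_distrib
      by (intro sum.cong refl) (simp add: field_simps)
    ultimately show ?thesis by simp
  qed
  also have "\<dots> \<le> (\<Sum>j\<le>L. \<Sum>l\<le>L. b j * b l * R j l)" by (intro sum_mono diag)
  also have "\<dots> = (\<Sum>i\<in>I. \<Sum>j\<le>L. \<Sum>l\<le>L. b j * b l * Re (z i ^ j * cnj (z i ^ l)))"
  proof -
    have swap: "(\<Sum>i\<in>I. \<Sum>j\<le>L. \<Sum>l\<le>L. F i j l) = (\<Sum>j\<le>L. \<Sum>l\<le>L. \<Sum>i\<in>I. F i j l)"
      for F :: "'i \<Rightarrow> nat \<Rightarrow> nat \<Rightarrow> real"
      by (subst sum.swap, intro sum.cong refl, rule sum.swap)
    show ?thesis unfolding swap R_def Re_sum sum_distrib_left ..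
  qed
  also have "\<dots> = (\<Sum>i\<in>I. (norm (\<Sum>j\<le>L. of_real (b j) * z i ^ j))\<^sup>2)" by (simp only: sq)
  finally show ?thesis unfolding \<sigma>_def .
qed

text \<open>The \<open>b j\<close> are the coefficients of the \<open>k\<close>-th power of
  \<open>1 + X + ... + X ^ G\<close>. The polynomial is taken over the complex numbers, so the
  induction carries nonnegative real part and vanishing imaginary part together through the
  convolution.\<close>

lemma geometric_sum_power_expansion:
  "\<exists>b :: nat \<Rightarrow> real. (\<forall>j. b j \<ge> 0) \<and>
    (\<forall>z::complex. (\<Sum>j<Suc G. z ^ j) ^ k = (\<Sum>j\<le>k * G. of_real (b j) * z ^ j))"
proof -
  define Q where "Q = (\<Sum>j<Suc G. monom (1::complex) j)"
  have degQ: "degree Q \<le> G" unfolding Q_def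
    by (intro degree_sum_le) (auto simp: degree_monom_eq)
  have cQ: "coeff Q i = of_real (if i \<le> G then 1 else 0)" for i
    unfolding Q_def by (auto simp: coeff_sum)
  have nn: "0 \<le> Re (coeff (Q ^ m) i) \<and> Im (coeff (Q ^ m) i) = 0" for m i
  proof (induction m arbitrary: i)
    case 0
    show ?case by simp
  next
    case (Suc m)
    have "coeff (Q ^ Suc m) i = (\<Sum>l\<le>i. of_real (if l \<le> G then 1 else 0) * coeff (Q ^ m) (i - l))"
      by (simp only: power_Suc coeff_mult cQ)
    thus ?case using Suc.IH by (auto simp: Re_sum Im_sum intro!: sum_nonneg)
  qed
  define b where "b i = Re (coeff (Q ^ k) i)" for i
  have b: "b i \<ge> 0" "coeff (Q ^ k) i = of_real (b i)" for i
    using nn[of k i] by (auto simp: b_def complex_eq_iff)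
  have deg: "degree (Q ^ k) \<le> k * G"
    using degree_power_le[of Q k] mult_le_mono1[OF degQ, of k] by (simp only: mult.commute[of k])
  have "(\<Sum>j<Suc G. z ^ j) ^ k = (\<Sum>j\<le>k * G. of_real (b j) * z ^ j)" for z :: complex
  proof -
    have "(\<Sum>j<Suc G. z ^ j) ^ k = poly (Q ^ k) z" by (simp add: Q_def poly_sum poly_monom poly_power)
    also have "\<dots> = (\<Sum>j\<le>degree (Q ^ k). coeff (Q ^ k) j * z ^ j)" by (rule poly_altdef)
    also have "\<dots> = (\<Sum>j\<le>k * G. coeff (Q ^ k) j * z ^ j)"
      using deg by (intro sum.mono_neutral_left) (auto simp: coeff_eq_0)
    finally show ?thesis by (simp add: b)
  qed
  with b(1) show ?thesis by blast
qed

text \<open>The powers of the Dirichlet kernel have nonnegative coefficients \<open>b j\<close>, which gives the lower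
  bound \<open>(\<Sum>j. b j)\<^sup>2 / (k * G + 1)\<close> for the diagonal \<open>\<Sum>j. (b j)\<^sup>2\<close>; raising to the power \<open>k\<close> makes
  the kernel negligible away from the integers.\<close>

lemma Fejer_power_inequality:
  fixes z :: "'i \<Rightarrow> complex"
  assumes z: "\<And>i. i \<in> I \<Longrightarrow> norm (z i) = 1"
    and small: "\<And>i. i \<in> I \<Longrightarrow> norm (\<Sum>j<Suc G. z i ^ j) \<le> B"
    and S: "4 * (\<Sum>h=1..k * G. norm (\<Sum>i\<in>I. z i ^ h)) \<le> real (card I)"
    and ne: "finite I" "I \<noteq> {}"
  shows "real (Suc G) ^ (2 * k) \<le> 2 * real (k * G + 1) * B ^ (2 * k)"
proof -
  obtain b where b: "\<And>j. b j \<ge> 0"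
    "\<And>z::complex. (\<Sum>j<Suc G. z ^ j) ^ k = (\<Sum>j\<le>k * G. of_real (b j) * z ^ j)"
    using geometric_sum_power_expansion[of G k] by blast
  let ?L = "k * G"
  \<comment> \<open>Evaluation at 1 gives the total mass of the coefficients.\<close>
  have "of_real (real (Suc G) ^ k) = (complex_of_real (\<Sum>j\<le>?L. b j))"
    using b(2)[of 1] by simp
  hence sb: "real (Suc G) ^ k = (\<Sum>j\<le>?L. b j)" using of_real_eq_iff by blast
  have "(\<Sum>j\<le>?L. b j)\<^sup>2 \<le> real (card {..?L}) * (\<Sum>j\<le>?L. (b j)\<^sup>2)"
    using sum_squared_le_sum_of_squares[of b "{..?L}"] by (simp add: mult.commute)
  hence "real (Suc G) ^ (2 * k) \<le> real (?L + 1) * (\<Sum>j\<le>?L. (b j)\<^sup>2)"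
    unfolding sb[symmetric] by (simp add: power_mult[symmetric] mult.commute)
  also have "\<dots> \<le> real (?L + 1) * (2 * B ^ (2 * k))"
  proof (rule mult_left_mono)
    have c: "real (card I) > 0" using ne by (simp add: card_gt_0_iff)
    \<comment> \<open>By \<open>S\<close> the power sums take away at most half of
      \<open>card I\<close>.\<close>
    have "(\<Sum>j\<le>?L. (b j)\<^sup>2) * (real (card I) / 2)
      \<le> (\<Sum>j\<le>?L. (b j)\<^sup>2) * (real (card I) - 2 * (\<Sum>h=1..?L. norm (\<Sum>i\<in>I. z i ^ h)))"
      using S by (intro mult_left_mono sum_nonneg) auto
    also have "\<dots> \<le> (\<Sum>i\<in>I. (norm (\<Sum>j\<le>?L. of_real (b j) * z i ^ j))\<^sup>2)"
      by (rule sum_norm_square_trig_ge) (use z b in auto)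
    also have "\<dots> \<le> (\<Sum>i\<in>I. B ^ (2 * k))"
    proof (rule sum_mono)
      fix i assume "i \<in> I"
      hence "norm (\<Sum>j<Suc G. z i ^ j) ^ (2 * k) \<le> B ^ (2 * k)" by (intro power_mono small) auto
      thus "(norm (\<Sum>j\<le>?L. of_real (b j) * z i ^ j))\<^sup>2 \<le> B ^ (2 * k)"
        unfolding b(2)[symmetric] norm_power by (simp add: power_mult[symmetric] mult.commute)
    qed
    finally have "(\<Sum>j\<le>?L. (b j)\<^sup>2) * real (card I) \<le> (2 * B ^ (2 * k)) * real (card I)" by (simp add: mult_ac)
    thus "(\<Sum>j\<le>?L. (b j)\<^sup>2) \<le> 2 * B ^ (2 * k)" using c by (simp only: mult_le_cancel_right_pos)
  qed simp
  finally show ?thesis by (simp only: mult_ac)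
qed

section \<open>A bilinear exponential sum\<close>

definition e :: "real \<Rightarrow> complex" where "e x = cis (2 * pi * x)"

lemma norm_e [simp]: "norm (e x) = 1"
  by (simp add: e_def)

lemma e_add: "e (x + y) = e x * e y"
  by (simp add: e_def cis_mult distrib_left)

lemma cnj_e: "cnj (e x) = e (- x)"
  by (simp add: e_def cis_cnj)

lemma e_power: "e x ^ n = e (real n * x)"
  by (simp add: e_def Complex.DeMoivre mult_ac)

lemma e_of_int [simp]: "e (of_int n) = 1"
  unfolding e_def by (rule cis_multiple_2pi) simp

lemma norm_e_minus_1: "norm (e x - 1) = 2 * \<bar>sin (pi * x)\<bar>"
  using dist_exp_i_1[of "2 * pi * x"] by (simp add: e_def cis_conv_exp)

text \<open>The Taylor bound gives \<open>sin x \<ge> x - x ^ 3 / 6\<close>, and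
  \<open>x ^ 2 \<le> 3\<close> on this range. The endpoint \<open>5 / 3\<close> is a rational number
  just above \<open>pi / 2\<close>, so that \<open>pi * r\<close> with \<open>r \<le> 1 / 2\<close>
  is covered.\<close>

lemma half_le_sin:
  assumes "0 \<le> x" "x \<le> 5 / 3"
  shows "x / 2 \<le> sin (x :: real)"
proof -
  have "\<bar>sin x - (\<Sum>m<3. sin_coeff m * x ^ m)\<bar> \<le> inverse (fact 3) * \<bar>x\<bar> ^ 3"
    by (rule Maclaurin_sin_bound)
  moreover have "(\<Sum>m<3. sin_coeff m * x ^ m) = x"
    by (simp add: numeral_3_eq_3 sin_coeff_def)
  moreover have "inverse (fact 3) * \<bar>x\<bar> ^ 3 = x ^ 3 / 6"
    using assms by (simp add: fact_numeral)
  ultimately have "x - x ^ 3 / 6 \<le> sin x" by linarith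
  moreover have "x * x\<^sup>2 \<le> x * 3"
    using assms power_mono[of x "5 / 3" 2] by (intro mult_left_mono) (auto simp: power_divide)
  hence "x ^ 3 \<le> 3 * x" by (simp add: power3_eq_cube power2_eq_square mult.commute)
  ultimately show ?thesis by linarith
qed

text \<open>By periodicity \<open>x\<close> may be replaced by its signed distance \<open>r\<close>
  to the nearest integer. Then \<open>\<bar>sin (pi * r)\<bar>\<close> is at least
  \<open>pi / 2\<close> times \<open>\<bar>r\<bar>\<close>, hence at least
  \<open>\<bar>r\<bar>\<close>.\<close>

lemma norm_e_minus_1_ge:
  assumes "\<And>b::int. \<delta> \<le> \<bar>x - of_int b\<bar>"
  shows "2 * \<delta> \<le> norm (e x - 1)"
proof -
  define r where "r = x - of_int (round x)"
  have r: "\<bar>r\<bar> \<le> 1 / 2" unfolding r_def using of_int_round_abs_le[of x] by (simp add: abs_minus_commute)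
  have "e x = e r * e (of_int (round x))" unfolding e_add[symmetric] r_def by simp
  hence "e x = e r" by simp
  hence "norm (e x - 1) = 2 * \<bar>sin (pi * r)\<bar>" by (simp add: norm_e_minus_1)
  also have "\<bar>sin (pi * r)\<bar> = \<bar>sin (pi * \<bar>r\<bar>)\<bar>" by (simp add: abs_if)
  finally have eq: "norm (e x - 1) = 2 * \<bar>sin (pi * \<bar>r\<bar>)\<bar>" .
  have "\<bar>r\<bar> \<le> \<bar>sin (pi * \<bar>r\<bar>)\<bar>"
  proof -
    have "pi * \<bar>r\<bar> \<le> pi * (1 / 2)" using r by (intro mult_left_mono) auto
    also have "\<dots> \<le> 5 / 3" using pi_approx by simp
    finally have "pi * \<bar>r\<bar> / 2 \<le> sin (pi * \<bar>r\<bar>)" by (intro half_le_sin) simp_all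
    moreover have "\<bar>r\<bar> * 2 \<le> \<bar>r\<bar> * pi" using pi_ge_two by (intro mult_left_mono) auto
    ultimately show ?thesis by (simp add: mult.commute)
  qed
  thus ?thesis using assms[of "round x"] unfolding eq by (simp add: r_def)
qed

lemma norm_geometric_sum_e_le:
  assumes "\<And>b::int. \<delta> \<le> \<bar>x - of_int b\<bar>" and \<delta>: "\<delta> > 0"
  shows "norm (\<Sum>j<n. e x ^ j) \<le> 1 / \<delta>"
proof -
  have ge: "2 * \<delta> \<le> norm (e x - 1)" by (rule norm_e_minus_1_ge) (rule assms(1))
  hence ne: "e x \<noteq> 1" using \<delta> by auto
  have "norm (\<Sum>j<n. e x ^ j) = norm (e x ^ n - 1) / norm (e x - 1)"
    using ne by (simp add: sum_gp_strict norm_divide norm_minus_commute)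
  also have "\<dots> \<le> 2 / norm (e x - 1)"
    by (intro divide_right_mono order.trans[OF norm_triangle_ineq4]) (auto simp: norm_power)
  also have "\<dots> \<le> 2 / (2 * \<delta>)" using ge \<delta> by (intro frac_le) auto
  finally show ?thesis by simp
qed

lemma e_eq_1_imp_Ints:
  assumes "e x = 1"
  shows "x \<in> \<int>"
proof (rule ccontr)
  assume "x \<notin> \<int>"
  hence "x \<noteq> of_int (round x)" by (metis Ints_of_int)
  hence "0 < \<bar>x - of_int (round x)\<bar>" by simp
  moreover have "2 * \<bar>x - of_int (round x)\<bar> \<le> norm (e x - 1)"
    by (rule norm_e_minus_1_ge) (rule round_diff_minimal)
  ultimately show False using assms by simp
qed

section \<open>Orthogonality and mean squares modulo \<open>q\<close>\<close>

lemma sum_e_complete: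
  assumes q: "q > 0"
  shows "(\<Sum>n<q. e (real n * (of_int j / real q))) = (if int q dvd j then of_nat q else 0)"
proof (cases "int q dvd j")
  case True
  then obtain c where "j = int q * c" by blast
  hence "of_int j / real q = of_int c" using q by simp
  hence "e (real n * (of_int j / real q)) = 1" for n
    by (metis e_power e_of_int power_one)
  thus ?thesis using True by simp
next
  case False
  let ?z = "e (of_int j / real q)"
  have "?z \<noteq> 1"
  proof
    assume "?z = 1"
    then obtain c where "of_int j / real q = of_int c" using e_eq_1_imp_Ints Ints_cases by metis
    hence "(of_int j :: real) = of_int (int q * c)" using q by (simp add: field_simps)
    hence "j = int q * c" by (simp only: of_int_eq_iff)
    thus False using False by simp
  qed
  moreover have "?z ^ q = 1" using q by (simp add: e_power)
  ultimately have "(\<Sum>n<q. ?z ^ n) = 0" by (simp add: sum_gp_strict)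
  thus ?thesis using False by (simp add: e_power)
qed

lemma card_residue_class_le:
  fixes q N r :: nat
  assumes q: "q > 0"
  shows "card {x\<in>{1..N}. x mod q = r} \<le> N div q + 1"
proof -
  have "inj_on (\<lambda>x. x div q) {x\<in>{1..N}. x mod q = r}"
    by (intro inj_onI) (metis (mono_tags, lifting) div_mult_mod_eq mem_Collect_eq)
  moreover have "(\<lambda>x. x div q) ` {x\<in>{1..N}. x mod q = r} \<subseteq> {..N div q}"
    by (auto intro: div_le_mono)
  ultimately have "card {x\<in>{1..N}. x mod q = r} \<le> card {..N div q}"
    by (intro card_inj_on_le) auto
  thus ?thesis by simp
qed

text \<open>After opening the square, summation over \<open>n\<close> keeps only the pairs with
  \<open>p\<close> congruent to \<open>p'\<close> modulo \<open>q\<close>, because \<open>a\<close>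
  is invertible there. For each \<open>p\<close> the count of such \<open>p'\<close> is at most that
  of a residue class in \<open>{1..N}\<close>.\<close>

lemma sum_norm_square_complete_le:
  fixes q N :: nat and a :: int and B :: "nat set"
  assumes q: "q > 0" and a: "coprime a (int q)" and B: "B \<subseteq> {1..N}"
  shows "(\<Sum>n<q. (norm (\<Sum>p\<in>B. e (real n * (of_int (a * int p) / real q))))\<^sup>2)
    \<le> real q * real (card B) * (real N / real q + 1)"
proof -
  have finB: "finite B" using B finite_subset by blast
  have sq: "complex_of_real ((norm (\<Sum>p\<in>B. e (real n * (of_int (a * int p) / real q))))\<^sup>2)
     = (\<Sum>p\<in>B. \<Sum>p'\<in>B. e (real n * (of_int (a * (int p - int p')) / real q)))" for n
    unfolding complex_norm_square sum_product cnj_sum cnj_e e_add[symmetric]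
    by (intro sum.cong refl arg_cong[of _ _ e]) (simp add: right_diff_distrib diff_divide_distrib)
  have "complex_of_real (\<Sum>n<q. (norm (\<Sum>p\<in>B. e (real n * (of_int (a * int p) / real q))))\<^sup>2)
     = (\<Sum>n<q. \<Sum>p\<in>B. \<Sum>p'\<in>B. e (real n * (of_int (a * (int p - int p')) / real q)))"
    by (simp only: of_real_sum sq)
  also have "\<dots> = (\<Sum>p\<in>B. \<Sum>p'\<in>B. \<Sum>n<q. e (real n * (of_int (a * (int p - int p')) / real q)))"
    by (subst sum.swap, rule sum.cong[OF refl], rule sum.swap)
  also have "\<dots> = (\<Sum>p\<in>B. \<Sum>p'\<in>B. if int q dvd a * (int p - int p') then of_nat q else 0)"
    by (simp only: sum_e_complete[OF q])
  also have "\<dots> = (\<Sum>p\<in>B. \<Sum>p'\<in>B. if p' mod q = p mod q then of_nat q else 0)"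
  proof (intro sum.cong refl)
    fix p p'
    have "int q dvd a * (int p - int p') \<longleftrightarrow> int q dvd int p - int p'"
      using a by (simp add: coprime_dvd_mult_right_iff coprime_commute)
    also have "\<dots> \<longleftrightarrow> int p mod int q = int p' mod int q" by (simp add: mod_eq_dvd_iff)
    also have "\<dots> \<longleftrightarrow> p' mod q = p mod q" unfolding zmod_int[symmetric] by auto
    finally show "(if int q dvd a * (int p - int p') then of_nat q else 0 :: complex)
        = (if p' mod q = p mod q then of_nat q else 0)" by simp
  qed
  also have "\<dots> = complex_of_real (\<Sum>p\<in>B. real q * real (card {p'\<in>B. p' mod q = p mod q}))"
    using finB by (simp add: sum.If_cases Int_def mult.commute)
  finally have eq: "(\<Sum>n<q. (norm (\<Sum>p\<in>B. e (real n * (of_int (a * int p) / real q))))\<^sup>2)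
     = (\<Sum>p\<in>B. real q * real (card {p'\<in>B. p' mod q = p mod q}))"
    by (simp only: of_real_eq_iff)
  have "real (card {p'\<in>B. p' mod q = r}) \<le> real N / real q + 1" for r
  proof -
    have "card {p'\<in>B. p' mod q = r} \<le> card {p'\<in>{1..N}. p' mod q = r}"
      using B by (intro card_mono) auto
    also have "\<dots> \<le> N div q + 1" by (rule card_residue_class_le[OF q])
    finally have "real (card {p'\<in>B. p' mod q = r}) \<le> real (N div q + 1)" by (simp only: of_nat_le_iff)
    also have "\<dots> \<le> real N / real q + 1" using of_nat_div_le_of_nat[of N q, where ?'a = real] by simp
    finally show ?thesis .
  qed
  hence "(\<Sum>p\<in>B. real q * real (card {p'\<in>B. p' mod q = p mod q})) \<le> (\<Sum>p\<in>B. real q * (real N / real q + 1))"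
    by (intro sum_mono mult_left_mono) auto
  thus ?thesis unfolding eq by (simp add: mult_ac)
qed

lemma sum_periodic:
  fixes f :: "nat \<Rightarrow> real"
  assumes "\<And>n. f (n + q) = f n"
  shows "(\<Sum>n<J * q. f n) = real J * (\<Sum>n<q. f n)"
proof -
  have per: "f (n + m * q) = f n" for n m
  proof (induction m)
    case (Suc m)
    thus ?case using assms[of "n + m * q"] by (simp add: add_ac)
  qed simp
  have "(\<Sum>n<J * q. f n) = (\<Sum>m<J. sum f {m * q..<m * q + q})"
    by (rule sum.nat_group[symmetric])
  also have "\<dots> = (\<Sum>m<J. \<Sum>n<q. f n)"
  proof (rule sum.cong[OF refl])
    fix m
    have "sum f {m * q..<m * q + q} = (\<Sum>n\<in>{0..<q}. f (n + m * q))"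
      using sum.shift_bounds_nat_ivl[of f 0 "m * q" q] by (simp add: add.commute)
    thus "sum f {m * q..<m * q + q} = (\<Sum>n<q. f n)" by (simp add: per lessThan_atLeast0)
  qed
  finally show ?thesis by simp
qed

text \<open>Since the primes in \<open>A\<close> exceed \<open>L\<close>, the products \<open>h * p\<close> with \<open>h \<le> L\<close> and \<open>p \<in> A\<close> are
  pairwise distinct, so they can be merged into one long variable before applying Cauchy-Schwarz.\<close>

lemma bilinear_exponential_sum_bound:
  fixes q N L :: nat and a :: int and A B :: "nat set"
  assumes q: "q > 0" and a: "coprime a (int q)" and B: "B \<subseteq> {1..N}" and A: "A \<subseteq> {1..N}"
    and prime: "\<And>p. p \<in> A \<Longrightarrow> prime p" and large: "\<And>p. p \<in> A \<Longrightarrow> L < p"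
  shows "(\<Sum>h=1..L. norm (\<Sum>(p,p')\<in>A \<times> B. e (of_int a * real p * real p' / real q) ^ h))\<^sup>2
    \<le> (real L * real (card A)) * ((real L * real N + real q) * (real (card B) * (real N / real q + 1)))"
proof -
  define E where "E n = norm (\<Sum>p\<in>B. e (real n * (of_int (a * int p) / real q)))" for n
  have finA: "finite A" and finB: "finite B" using A B finite_subset by blast+
  define X where "X = {1..L} \<times> A"
  have inj: "inj_on (\<lambda>(h,p). h * p) X"
  proof (rule inj_onI, clarify)
    fix h p h' p' assume *: "(h,p) \<in> X" "(h',p') \<in> X" "h * p = h' * p'"
    have "p = p'"
    proof (rule ccontr)
      assume "p \<noteq> p'"
      hence "\<not> p dvd p'" using * prime unfolding X_def by (auto simp: primes_dvd_imp_eq)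
      moreover have "p dvd h' * p'" using *(3) by (metis dvd_triv_right)
      ultimately have "p dvd h'" using * prime unfolding X_def by (auto simp: prime_dvd_mult_iff)
      hence "p \<le> h'" using * unfolding X_def by (auto dest: dvd_imp_le)
      thus False using * large[of p] unfolding X_def by auto
    qed
    moreover have "p > 0" using * large[of p] unfolding X_def by auto
    ultimately show "h = h' \<and> p = p'" using * by auto
  qed
  \<comment> \<open>The number of full periods of length \<open>q\<close> needed to cover all
    products up to \<open>L * N\<close>. The extra period costs the summand \<open>q\<close> in the
    bound.\<close>
  define J where "J = L * N div q + 1"
  have img: "(\<lambda>(h,p). h * p) ` X \<subseteq> {..<J * q}"
  proof (rule image_subsetI)
    fix x assume "x \<in> X"
    then obtain h p where x: "x = (h, p)" "(h, p) \<in> X" by (cases x) auto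
    have "h * p \<le> L * N" using x(2) unfolding X_def using A by (intro mult_le_mono) auto
    also have "L * N < J * q" unfolding J_def using q dividend_less_div_times[of q "L * N"]
      by (simp add: algebra_simps)
    finally show "(case x of (h, p) \<Rightarrow> h * p) \<in> {..<J * q}" by (simp add: x(1))
  qed
  have "(\<Sum>h=1..L. norm (\<Sum>(p,p')\<in>A \<times> B. e (of_int a * real p * real p' / real q) ^ h))
      \<le> (\<Sum>h=1..L. \<Sum>p\<in>A. E (h * p))"
  proof (rule sum_mono)
    fix h
    have "(\<Sum>(p,p')\<in>A \<times> B. e (of_int a * real p * real p' / real q) ^ h)
      = (\<Sum>p\<in>A. \<Sum>p'\<in>B. e (real (h * p) * (of_int (a * int p') / real q)))"
      unfolding sum.cartesian_product[symmetric] e_power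
      by (intro sum.cong refl arg_cong[of _ _ e]) (simp add: field_simps)
    thus "norm (\<Sum>(p,p')\<in>A \<times> B. e (of_int a * real p * real p' / real q) ^ h) \<le> (\<Sum>p\<in>A. E (h * p))"
      unfolding E_def by (simp only: norm_sum)
  qed
  also have "\<dots> = (\<Sum>x\<in>X. 1 * E (case x of (h,p) \<Rightarrow> h * p))"
    unfolding X_def sum.cartesian_product by (intro sum.cong refl) auto
  finally have "(\<Sum>h=1..L. norm (\<Sum>(p,p')\<in>A \<times> B. e (of_int a * real p * real p' / real q) ^ h))\<^sup>2
      \<le> (\<Sum>x\<in>X. 1 * E (case x of (h,p) \<Rightarrow> h * p))\<^sup>2"
    by (intro power_mono sum_nonneg) auto
  \<comment> \<open>Cauchy-Schwarz against the constant 1. By injectivity the second factor becomes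
    a sum over distinct \<open>n\<close>, which can be completed to \<open>J\<close>
    periods.\<close>
  also have "\<dots> \<le> (\<Sum>x\<in>X. 1\<^sup>2) * (\<Sum>x\<in>X. (E (case x of (h,p) \<Rightarrow> h * p))\<^sup>2)"
    by (rule Cauchy_Schwarz_ineq_sum)
  also have "(\<Sum>x\<in>X. 1\<^sup>2) = real L * real (card A)"
    by (simp add: X_def card_cartesian_product)
  also have "(\<Sum>x\<in>X. (E (case x of (h,p) \<Rightarrow> h * p))\<^sup>2) = (\<Sum>n\<in>(\<lambda>(h,p). h * p) ` X. (E n)\<^sup>2)"
    by (subst sum.reindex[OF inj]) (simp add: o_def)
  also have "real L * real (card A) * \<dots> \<le>
      real L * real (card A) * ((real L * real N + real q) * (real (card B) * (real N / real q + 1)))"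
  proof (rule mult_left_mono)
    have "(\<Sum>n\<in>(\<lambda>(h,p). h * p) ` X. (E n)\<^sup>2) \<le> (\<Sum>n<J * q. (E n)\<^sup>2)"
      using img by (intro sum_mono2) auto
    also have "\<dots> = real J * (\<Sum>n<q. (E n)\<^sup>2)"
    proof (rule sum_periodic)
      fix n
      have "real (n + q) * (of_int (a * int p) / real q)
         = real n * (of_int (a * int p) / real q) + of_int (a * int p)" for p
        using q by (simp add: field_simps)
      thus "(E (n + q))\<^sup>2 = (E n)\<^sup>2" unfolding E_def by (simp only: e_add e_of_int mult_1_right)
    qed
    also have "\<dots> \<le> real J * (real q * real (card B) * (real N / real q + 1))"
      unfolding E_def by (intro mult_left_mono sum_norm_square_complete_le q a B) auto
    also have "\<dots> = (real J * real q) * (real (card B) * (real N / real q + 1))" by simp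
    also have "\<dots> \<le> (real L * real N + real q) * (real (card B) * (real N / real q + 1))"
    proof (rule mult_right_mono)
      have "J * q \<le> L * N + q" unfolding J_def using div_times_less_eq_dividend[of "L * N" q] by simp
      hence "real (J * q) \<le> real (L * N + q)" by (simp only: of_nat_le_iff)
      thus "real J * real q \<le> real L * real N + real q" by simp
    qed auto
    finally show "(\<Sum>n\<in>(\<lambda>(h,p). h * p) ` X. (E n)\<^sup>2)
      \<le> (real L * real N + real q) * (real (card B) * (real N / real q + 1))" .
  qed simp
  finally show ?thesis by simp
qed

section \<open>Sums of two fractions with prime denominators\<close>

text \<open>If every \<open>a * p * p' / q\<close> stayed \<open>\<delta>\<close> away from the
  integers, all geometric sums would be at most \<open>1 / \<delta>\<close>. The condition
  \<open>size\<close> is what the bilinear bound needs to make the power sums at most a quarter of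
  the number of pairs, and then the Fejer inequality contradicts \<open>big\<close>.\<close>

lemma exists_close_product:
  fixes q N k G :: nat and a :: int and A B :: "nat set" and \<delta> :: real
  assumes q: "q > 0" and a: "coprime a (int q)" and A: "A \<subseteq> {1..N}" and B: "B \<subseteq> {1..N}"
    and prime: "\<And>p. p \<in> A \<Longrightarrow> prime p" and large: "\<And>p. p \<in> A \<Longrightarrow> k * G < p"
    and ne: "A \<noteq> {}" "B \<noteq> {}" and \<delta>: "\<delta> > 0"
    and size: "16 * (real (k * G) * (real (k * G) * real N + real q) * (real N / real q + 1))
      \<le> real (card A) * real (card B)"
    and big: "2 * (real (k * G) + 1) < (\<delta> * real (Suc G)) ^ (2 * k)"
  shows "\<exists>p\<in>A. \<exists>p'\<in>B. \<exists>b::int. \<bar>of_int a * real p * real p' / real q - of_int b\<bar> < \<delta>"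
proof (rule ccontr)
  assume "\<not> ?thesis"
  hence far: "\<delta> \<le> \<bar>of_int a * real p * real p' / real q - of_int b\<bar>" if "p \<in> A" "p' \<in> B" for p p' b
    using that by (meson not_less)
  have fin: "finite A" "finite B" using A B finite_subset by blast+
  define z where "z = (\<lambda>(p,p'). e (of_int a * real p * real p' / real q))"
  define S where "S = (\<Sum>h=1..k * G. norm (\<Sum>i\<in>A \<times> B. z i ^ h))"
  have "S\<^sup>2 \<le> (real (k * G) * real (card A)) *
      ((real (k * G) * real N + real q) * (real (card B) * (real N / real q + 1)))"
  proof -
    have "z i ^ h = (case i of (p,p') \<Rightarrow> e (of_int a * real p * real p' / real q) ^ h)" for i h
      by (simp add: z_def case_prod_beta)
    thus ?thesis unfolding S_def using bilinear_exponential_sum_bound[OF q a B A prime large]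
      by (simp only:)
  qed
  also have "16 * \<dots> = (16 * (real (k * G) * (real (k * G) * real N + real q) * (real N / real q + 1)))
      * (real (card A) * real (card B))" by (simp only: mult_ac)
  also have "\<dots> \<le> (real (card A) * real (card B)) * (real (card A) * real (card B))"
    using size by (rule mult_right_mono) simp
  finally have "(4 * S)\<^sup>2 \<le> (real (card A) * real (card B))\<^sup>2"
    by (simp add: power_mult_distrib power2_eq_square)
  hence S: "4 * S \<le> real (card (A \<times> B))"
    using power2_le_imp_le[of "4 * S" "real (card A) * real (card B)"] by (simp add: card_cartesian_product)
  have "real (Suc G) ^ (2 * k) \<le> 2 * real (k * G + 1) * (1 / \<delta>) ^ (2 * k)"
  proof (rule Fejer_power_inequality[where z = z and I = "A \<times> B"])
    show "norm (z i) = 1" for i unfolding z_def by (cases i) simp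
    show "norm (\<Sum>j<Suc G. z i ^ j) \<le> 1 / \<delta>" if "i \<in> A \<times> B" for i
      using that far \<delta> unfolding z_def by (cases i) (auto simp del: sum.lessThan_Suc intro!: norm_geometric_sum_e_le)
    show "4 * (\<Sum>h = 1..k * G. norm (\<Sum>i\<in>A \<times> B. z i ^ h)) \<le> real (card (A \<times> B))"
      using S unfolding S_def .
    show "finite (A \<times> B)" "A \<times> B \<noteq> {}" using fin ne by auto
  qed
  hence "real (Suc G) ^ (2 * k) * \<delta> ^ (2 * k) \<le> 2 * real (k * G + 1)"
    using \<delta> by (simp add: power_divide pos_le_divide_eq)
  thus False using big by (simp add: power_mult_distrib mult.commute)
qed

text \<open>Bezout's identity \<open>u * q\<^sub>1 + v * q\<^sub>2 = 1\<close> splits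
  \<open>b / (q\<^sub>1 * q\<^sub>2)\<close> into
  \<open>b * v / q\<^sub>1 + b * u / q\<^sub>2\<close>.\<close>

lemma split_over_two_primes:
  fixes a b :: int and q q\<^sub>1 q\<^sub>2 :: nat
  assumes "prime q\<^sub>1" "prime q\<^sub>2" "q\<^sub>1 \<noteq> q\<^sub>2"
    and close: "\<bar>of_int a * real q\<^sub>1 * real q\<^sub>2 / real q - of_int b\<bar> < \<delta>"
  obtains a\<^sub>1 a\<^sub>2 :: int
  where "\<bar>of_int a / real q - of_int a\<^sub>1 / real q\<^sub>1 - of_int a\<^sub>2 / real q\<^sub>2\<bar> \<le> \<delta> / (real q\<^sub>1 * real q\<^sub>2)"
proof -
  have pos: "real q\<^sub>1 > 0" "real q\<^sub>2 > 0" using assms(1,2) prime_gt_0_nat by auto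
  have "coprime (int q\<^sub>1) (int q\<^sub>2)" using assms primes_coprime by auto
  then obtain u v where uv: "u * int q\<^sub>1 + v * int q\<^sub>2 = 1"
    using bezout_int[of "int q\<^sub>1" "int q\<^sub>2"] by auto
  have "b = (b * u) * int q\<^sub>1 + (b * v) * int q\<^sub>2"
    using arg_cong[OF uv, of "\<lambda>x. b * x"] by (simp add: algebra_simps)
  hence "(of_int b :: real) = of_int ((b * u) * int q\<^sub>1 + (b * v) * int q\<^sub>2)" by (rule arg_cong)
  hence b: "(of_int b :: real) = of_int (b * u) * real q\<^sub>1 + of_int (b * v) * real q\<^sub>2" by simp
  have "of_int a / real q - of_int (b * v) / real q\<^sub>1 - of_int (b * u) / real q\<^sub>2
     = (of_int a * real q\<^sub>1 * real q\<^sub>2 / real q - of_int b) / (real q\<^sub>1 * real q\<^sub>2)"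
    \<comment> \<open>Division by zero yields 0, so the identity also holds for
      \<open>q = 0\<close>.\<close>
    unfolding b using pos by (cases "q = 0") (simp_all add: field_simps)
  hence "\<bar>of_int a / real q - of_int (b * v) / real q\<^sub>1 - of_int (b * u) / real q\<^sub>2\<bar>
     = \<bar>of_int a * real q\<^sub>1 * real q\<^sub>2 / real q - of_int b\<bar> / (real q\<^sub>1 * real q\<^sub>2)"
    using pos by (simp add: abs_divide)
  also have "\<dots> \<le> \<delta> / (real q\<^sub>1 * real q\<^sub>2)"
    using close pos by (intro divide_right_mono) auto
  finally show ?thesis by (rule that)
qed

text \<open>With \<open>T = N powr (1 - \<eta>)\<close>, Chebyshev's bound gives at least
  \<open>4 * T\<close> primes. Dropping those up to \<open>T\<close> leaves \<open>3 * T\<close>,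
  and removing a set of size \<open>\<lceil>T\<rceil> \<le> T + 1\<close> still leaves
  \<open>T\<close>, as \<open>T \<ge> 1\<close>. Disjointness later makes the two chosen primes
  distinct.\<close>

lemma eventually_disjoint_prime_sets:
  fixes \<eta> :: real
  assumes \<eta>: "0 < \<eta>" "\<eta> < 1"
  shows "eventually (\<lambda>N::real. \<exists>A B. A \<inter> B = {} \<and> (\<forall>p\<in>A \<union> B. prime p \<and> N powr (1 - \<eta>) < real p \<and> real p \<le> N) \<and>
    N powr (1 - \<eta>) \<le> real (card A) \<and> N powr (1 - \<eta>) \<le> real (card B)) at_top"
proof -
  have "eventually (\<lambda>N::real. 4 * N powr (1 - \<eta>) * ln N \<le> (N - 3) * ln 2) at_top"
    using \<eta> by real_asymp
  moreover have "eventually (\<lambda>N::real. 1 \<le> N powr (1 - \<eta>)) at_top"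
    using \<eta> by real_asymp
  ultimately show ?thesis using eventually_ge_at_top[of "3::real"]
  proof eventually_elim
    case (elim N)
    define T where "T = N powr (1 - \<eta>)"
    define P where "P = {p::nat. prime p \<and> real p \<le> N}"
    define S where "S = {p\<in>P. T < real p}"
    have finP: "finite P"
      unfolding P_def by (rule finite_subset[of _ "{..nat \<lfloor>N\<rfloor>}"]) (use elim in \<open>auto simp: le_nat_floor\<close>)
    have "4 * T * ln N \<le> real (card P) * ln N"
      using elim prime_count_lower_bound[of N] unfolding T_def P_def by linarith
    hence cP: "4 * T \<le> real (card P)" using elim by (simp add: mult_le_cancel_right)
    have "card P \<le> card (S \<union> {1..nat \<lfloor>T\<rfloor>})"
    proof (rule card_mono)
      show "finite (S \<union> {1..nat \<lfloor>T\<rfloor>})" using finP by (simp add: S_def)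
      show "P \<subseteq> S \<union> {1..nat \<lfloor>T\<rfloor>}"
      proof
        fix p assume p: "p \<in> P"
        hence "p \<ge> 1" using prime_ge_1_nat[of p] by (simp add: P_def)
        moreover have "p \<le> nat \<lfloor>T\<rfloor>" if "\<not> T < real p" using that by (simp add: le_nat_floor)
        ultimately show "p \<in> S \<union> {1..nat \<lfloor>T\<rfloor>}" using p by (auto simp: S_def)
      qed
    qed
    also have "\<dots> \<le> card S + nat \<lfloor>T\<rfloor>" using card_Un_le[of S "{1..nat \<lfloor>T\<rfloor>}"] by simp
    finally have "real (card P) \<le> real (card S) + T"
      using elim by (simp add: T_def) linarith
    hence cS: "3 * T \<le> real (card S)" using cP by linarith
    have "nat \<lceil>T\<rceil> \<le> card S" using cS elim unfolding T_def by linarith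
    then obtain A where A: "A \<subseteq> S" "card A = nat \<lceil>T\<rceil>" "finite A"
      by (rule obtain_subset_with_card_n)
    have "card (S - A) = card S - nat \<lceil>T\<rceil>" using A by (simp add: card_Diff_subset)
    hence "T \<le> real (card (S - A))" using cS elim \<open>nat \<lceil>T\<rceil> \<le> card S\<close> unfolding T_def by linarith
    moreover have "T \<le> real (card A)" unfolding A(2) by linarith
    ultimately show ?case using A(1) unfolding T_def
      by (intro exI[of _ A] exI[of _ "S - A"]) (auto simp: S_def P_def T_def)
  qed
qed

text \<open>The loss \<open>8 * \<eta>\<close> has two sources: \<open>6 * \<eta>\<close> from the
  tolerance \<open>\<delta>\<close>, and \<open>2 * \<eta>\<close> from the lower bound
  \<open>N powr (2 - 2 * \<eta>)\<close> for the product of the two primes.\<close>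

lemma eventually_approximation:
  fixes \<eta> :: real
  assumes \<eta>: "0 < \<eta>" "\<eta> \<le> 1 / 20"
  shows "eventually (\<lambda>N::real. \<forall>(a::int) (q::nat). 0 < q \<longrightarrow> real q \<le> N powr (5/4) \<longrightarrow> coprime a (int q) \<longrightarrow>
    (\<exists>(a\<^sub>1::int) (a\<^sub>2::int) (q\<^sub>1::nat) (q\<^sub>2::nat).
       prime q\<^sub>1 \<and> prime q\<^sub>2 \<and> q\<^sub>1 < q\<^sub>2 \<and> real q\<^sub>2 \<le> N \<and>
       \<bar>of_int a / real q - of_int a\<^sub>1 / real q\<^sub>1 - of_int a\<^sub>2 / real q\<^sub>2\<bar>
         \<le> 1 / (real q * N powr (5/4 - 8 * \<eta>)))) at_top"
proof -
  define k where "k = nat \<lceil>1 / \<eta>\<rceil>"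
  have "1 / \<eta> \<le> real k" unfolding k_def by (rule real_nat_ceiling_ge)
  hence k\<eta>: "1 \<le> real k * \<eta>" using \<eta> by (simp add: field_simps)
  have k1: "real k \<ge> 1" using k\<eta> \<eta> by (cases k) auto
  \<comment> \<open>These three inequalities supply \<open>size\<close>, \<open>large\<close> and
    \<open>big\<close> of \<open>exists_close_product\<close>, uniformly in \<open>a\<close> and
    \<open>q\<close>.\<close>
  have "eventually (\<lambda>N::real. 192 * real k ^ 2 * N powr (2 - 10 * \<eta>) \<le> N powr (2 - 2 * \<eta>)) at_top"
    using \<eta> k1 by real_asymp
  moreover have "eventually (\<lambda>N::real. 2 * real k * N powr (1/2 - 5 * \<eta>) \<le> N powr (1 - \<eta>)) at_top"
    using \<eta> k1 by real_asymp
  moreover have "eventually (\<lambda>N::real. 2 * (2 * real k * N powr (1/2 - 5 * \<eta>) + 1) < N powr 2) at_top"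
    using \<eta> k1 by real_asymp
  moreover have "\<eta> < 1" using \<eta> by simp
  note eventually_disjoint_prime_sets[OF \<eta>(1) this]
  ultimately show ?thesis using eventually_ge_at_top[of "1::real"]
  proof eventually_elim
    case (elim N)
    note size_ev = elim(1) and large_ev = elim(2) and big_ev = elim(3) and N1 = elim(5)
    obtain A B where disj: "A \<inter> B = {}"
      and AB: "\<And>p. p \<in> A \<union> B \<Longrightarrow> prime p \<and> N powr (1 - \<eta>) < real p \<and> real p \<le> N"
      and cA: "N powr (1 - \<eta>) \<le> real (card A)" and cB: "N powr (1 - \<eta>) \<le> real (card B)"
      using elim(4) by auto
    have Npos: "N > 0" and Tpos: "N powr (1 - \<eta>) > 0" using N1 by auto
    have ne: "A \<noteq> {}" "B \<noteq> {}" using cA cB Tpos by auto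
    define n where "n = nat \<lfloor>N\<rfloor>"
    have n: "real n \<le> N" using N1 by (simp add: n_def)
    have sub: "A \<subseteq> {1..n}" "B \<subseteq> {1..n}"
      using AB by (auto simp: n_def le_nat_floor prime_ge_1_nat Suc_leI prime_gt_0_nat)
    show ?case
    proof (intro allI impI)
      fix a :: int and q :: nat
      assume q0: "0 < q" and qN: "real q \<le> N powr (5/4)" and cop: "coprime a (int q)"
      define M where "M = N powr (3/4 + 6 * \<eta>)"
      define \<delta> where "\<delta> = M / real q"
      have \<delta>: "\<delta> > 0" using Npos q0 by (simp add: \<delta>_def M_def)
      have "\<exists>p\<in>A. \<exists>p'\<in>B. \<exists>b::int. \<bar>of_int a * real p * real p' / real q - of_int b\<bar> < \<delta>"
      \<comment> \<open>For \<open>q \<le> M\<close> we have \<open>\<delta> \<ge> 1\<close>. Otherwise \<open>G\<close> is about \<open>N powr \<eta> / \<delta>\<close>, and \<open>k \<ge> 1 / \<eta>\<close> gives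
        \<open>(\<delta> * G) ^ (2 * k) \<ge> N\<^sup>2\<close>, which beats the kernel length \<open>k * G\<close>.\<close>
      proof (cases "real q \<le> M")
        case True
        hence "1 \<le> \<delta>" using q0 by (simp add: \<delta>_def)
        moreover have "\<bar>x - of_int \<lfloor>x\<rfloor>\<bar> < 1" for x :: real by linarith
        ultimately show ?thesis using ne by (meson all_not_in_conv less_le_trans)
      next
        case False
        \<comment> \<open>This is \<open>N powr \<eta> / M\<close>, so \<open>real q * t\<close>
          equals \<open>N powr \<eta> / \<delta>\<close>.\<close>
        define t where "t = N powr (-3/4 - 5 * \<eta>)"
        define G where "G = nat \<lceil>real q * t\<rceil>"
        have tpos: "t > 0" using Npos by (simp add: t_def)
        have "M * t = N powr \<eta>" unfolding M_def t_def powr_add[symmetric] by (simp add: algebra_simps)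
        hence \<delta>t: "\<delta> * (real q * t) = N powr \<eta>" using q0 by (simp add: \<delta>_def)
        \<comment> \<open>As \<open>real q * t \<ge> 1\<close>, rounding it up to \<open>G\<close>
          at most doubles it.\<close>
        have "N powr \<eta> \<ge> 1" using N1 \<eta> by (simp add: ge_one_powr_ge_zero)
        hence "1 \<le> M * t" using \<open>M * t = N powr \<eta>\<close> by simp
        also have "M * t \<le> real q * t" using False tpos by (intro mult_right_mono) auto
        finally have G: "real q * t \<le> real G" "real G \<le> 2 * (real q * t)"
          unfolding G_def by linarith+
        have L: "real (k * G) \<le> 2 * real k * (real q * t)"
          using mult_left_mono[OF G(2), of "real k"] by simp
        have "real q * t \<le> N powr (5/4) * t" using qN tpos by (intro mult_right_mono) auto
        also have "\<dots> = N powr (1/2 - 5 * \<eta>)" unfolding t_def powr_add[symmetric] by simp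
        finally have qt: "real q * t \<le> N powr (1/2 - 5 * \<eta>)" .
        have L': "real (k * G) \<le> 2 * real k * N powr (1/2 - 5 * \<eta>)"
          using L mult_left_mono[OF qt, of "2 * real k"] by simp
        show ?thesis
        proof (rule exists_close_product[where N = n and k = k and G = G, OF q0 cop sub])
          show "prime p" if "p \<in> A" for p using AB that by auto
          show "k * G < p" if "p \<in> A" for p
          proof -
            have "real (k * G) < real p" using L' large_ev AB[of p] that by simp
            thus ?thesis by (simp only: of_nat_less_iff)
          qed
          show "2 * (real (k * G) + 1) < (\<delta> * real (Suc G)) ^ (2 * k)"
          proof -
            have "2 * (real (k * G) + 1) < N powr 2"
              by (rule le_less_trans[OF _ big_ev]) (use L' in \<open>simp add: mult_ac\<close>)
            also have "\<dots> \<le> N powr (\<eta> * real (2 * k))"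
              using k\<eta> N1 by (intro powr_mono) (auto simp: mult.commute)
            also have "\<dots> = (N powr \<eta>) ^ (2 * k)"
              unfolding powr_powr[symmetric] using Npos by (intro powr_realpow) simp
            also have "\<dots> \<le> (\<delta> * real (Suc G)) ^ (2 * k)"
              unfolding \<delta>t[symmetric] using \<delta> tpos G(1) by (intro power_mono mult_left_mono) auto
            finally show ?thesis .
          qed
          show "16 * (real (k * G) * (real (k * G) * real n + real q) * (real n / real q + 1))
              \<le> real (card A) * real (card B)"
          proof -
            \<comment> \<open>The bound \<open>\<eta> \<le> 1 / 20\<close> keeps the exponent
              \<open>1/4 - 5 * \<eta>\<close> nonnegative. It follows that the term \<open>q\<close>
              is dominated by the bound for \<open>k * G * n\<close>.\<close>
            have tN: "1 \<le> t * N"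
            proof -
              have "t * N = N powr (-3/4 - 5 * \<eta>) * N powr 1" using Npos by (simp add: t_def)
              also have "\<dots> = N powr (1/4 - 5 * \<eta>)" unfolding powr_add[symmetric] by simp
              also have "\<dots> \<ge> 1" using N1 \<eta> by (intro ge_one_powr_ge_zero) auto
              finally show ?thesis .
            qed
            have "real (k * G) * real n + real q \<le> 2 * real k * (real q * t) * N + real q"
              using L n Npos tpos by (intro add_right_mono mult_mono) auto
            moreover have "real q \<le> real k * (real q * t) * N"
            proof -
              have "1 \<le> real k * (t * N)" using mult_mono[OF k1 tN] by simp
              thus ?thesis using mult_left_mono[of 1 "real k * (t * N)" "real q"] by (simp add: mult_ac)
            qed
            ultimately have f2: "real (k * G) * real n + real q \<le> 3 * real k * (real q * t) * N" by linarith
            have NN: "N \<le> N powr (5/4)" using N1 powr_mono[of 1 "5/4" N] by simp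
            have "real n / real q + 1 = (real n + real q) / real q" using q0 by (simp add: field_simps)
            also have "\<dots> \<le> 2 * N powr (5/4) / real q"
              using n NN qN by (intro divide_right_mono) auto
            finally have f3: "real n / real q + 1 \<le> 2 * N powr (5/4) / real q" .
            \<comment> \<open>The constant is \<open>192 = 16 * 2 * 3 * 2\<close>. One factor
              \<open>q\<close> survives, and inserting its maximum \<open>N powr (5/4)\<close> gives
              the exponent \<open>2 - 10 * \<eta>\<close>.\<close>
            have "16 * (real (k * G) * (real (k * G) * real n + real q) * (real n / real q + 1))
              \<le> 16 * ((2 * real k * (real q * t)) * (3 * real k * (real q * t) * N) * (2 * N powr (5/4) / real q))"
              using Npos tpos by (intro mult_left_mono mult_mono L f2 f3) auto
            also have "\<dots> = (192 * real k ^ 2) * (t * t * N * N powr (5/4)) * real q"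
              using q0 by (simp add: power2_eq_square field_simps)
            also have "\<dots> \<le> (192 * real k ^ 2) * (t * t * N * N powr (5/4)) * N powr (5/4)"
              using qN Npos tpos by (intro mult_left_mono) auto
            also have "t * t * N * N powr (5/4) = N powr (-3/4 - 5 * \<eta>) * N powr (-3/4 - 5 * \<eta>) * N powr 1 * N powr (5/4)"
              using Npos by (simp add: t_def)
            also have "(192 * real k ^ 2) * \<dots> * N powr (5/4) = 192 * real k ^ 2 * N powr (2 - 10 * \<eta>)"
              unfolding mult.assoc powr_add[symmetric] by simp
            also have "\<dots> \<le> N powr (2 - 2 * \<eta>)" by (rule size_ev)
            also have "\<dots> = N powr (1 - \<eta>) * N powr (1 - \<eta>)" unfolding powr_add[symmetric] by simp
            also have "\<dots> \<le> real (card A) * real (card B)" using cA cB by (intro mult_mono) auto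
            finally show ?thesis .
          qed
        qed (use ne \<delta> in auto)
      qed
      then obtain p p' b where p: "p \<in> A" "p' \<in> B"
        and b: "\<bar>of_int a * real p * real p' / real q - of_int b\<bar> < \<delta>" by blast
      have pp: "prime p" "prime p'" "p \<noteq> p'" "real p \<le> N" "real p' \<le> N" using p AB disj by auto
      obtain c c' :: int where c: "\<bar>of_int a / real q - of_int c / real p - of_int c' / real p'\<bar>
          \<le> \<delta> / (real p * real p')"
        using split_over_two_primes[OF pp(1-3) b] by blast
      have "\<delta> / (real p * real p') \<le> \<delta> / (N powr (1 - \<eta>) * N powr (1 - \<eta>))"
        using p AB[of p] AB[of p'] Npos \<delta> by (intro divide_left_mono mult_mono mult_pos_pos) (auto simp: prime_gt_0_nat)
      also have "\<dots> = N powr (3/4 + 6 * \<eta>) / N powr (2 - 2 * \<eta>) / real q"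
        unfolding \<delta>_def M_def powr_add[symmetric] by simp
      also have "\<dots> = N powr (- (5/4 - 8 * \<eta>)) / real q"
        unfolding powr_diff[symmetric] by simp
      also have "\<dots> = 1 / (real q * N powr (5/4 - 8 * \<eta>))"
        unfolding powr_minus by (simp add: field_simps)
      finally have fin: "\<bar>of_int a / real q - of_int c / real p - of_int c' / real p'\<bar>
          \<le> 1 / (real q * N powr (5/4 - 8 * \<eta>))" using c by linarith
      show "\<exists>(a\<^sub>1::int) (a\<^sub>2::int) (q\<^sub>1::nat) (q\<^sub>2::nat).
         prime q\<^sub>1 \<and> prime q\<^sub>2 \<and> q\<^sub>1 < q\<^sub>2 \<and> real q\<^sub>2 \<le> N \<and>
         \<bar>of_int a / real q - of_int a\<^sub>1 / real q\<^sub>1 - of_int a\<^sub>2 / real q\<^sub>2\<bar>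
           \<le> 1 / (real q * N powr (5/4 - 8 * \<eta>))"
      proof (cases "p < p'")
        case True
        thus ?thesis using pp fin by blast
      next
        case False
        hence "p' < p" using pp(3) by simp
        moreover have "\<bar>of_int a / real q - of_int c' / real p' - of_int c / real p\<bar>
          \<le> 1 / (real q * N powr (5/4 - 8 * \<eta>))" using fin by linarith
        ultimately show ?thesis using pp by blast
      qed
    qed
  qed
qed

theorem theorem5:
  fixes \<epsilon> :: real
  assumes "\<epsilon> > 0"
  shows "\<exists>C::real. C > 0 \<and>
    (\<forall>(N::real) (\<alpha>::real) (a::int) (q::int).
       N \<ge> 3 \<longrightarrow> 1 \<le> q \<longrightarrow> real_of_int q \<le> N powr (5/4) \<longrightarrow> coprime a q \<longrightarrow>
       \<bar>\<alpha> - real_of_int a / real_of_int q\<bar> \<le> 1 / (real_of_int q * N powr (5/4)) \<longrightarrow>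
       (\<exists>(a\<^sub>1::int) (a\<^sub>2::int) (q\<^sub>1::nat) (q\<^sub>2::nat).
          prime q\<^sub>1 \<and> prime q\<^sub>2 \<and> q\<^sub>1 < q\<^sub>2 \<and> real q\<^sub>2 \<le> N \<and>
          \<bar>\<alpha> - real_of_int a\<^sub>1 / real q\<^sub>1 - real_of_int a\<^sub>2 / real q\<^sub>2\<bar>
            \<le> C / (real_of_int q * N powr (5/4 - \<epsilon>))))"
proof -
  define \<eta> where "\<eta> = min (\<epsilon> / 8) (1 / 20)"
  have \<eta>: "0 < \<eta>" "\<eta> \<le> 1 / 20" "8 * \<eta> \<le> \<epsilon>" using assms by (auto simp: \<eta>_def min_def)
  from eventually_approximation[OF \<eta>(1,2)] obtain N\<^sub>0 :: real where
    N\<^sub>0: "\<And>N (a::int) (q::nat). N \<ge> N\<^sub>0 \<Longrightarrow> 0 < q \<Longrightarrow> real q \<le> N powr (5/4) \<Longrightarrow> coprime a (int q) \<Longrightarrow>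
      (\<exists>(a\<^sub>1::int) (a\<^sub>2::int) (q\<^sub>1::nat) (q\<^sub>2::nat).
       prime q\<^sub>1 \<and> prime q\<^sub>2 \<and> q\<^sub>1 < q\<^sub>2 \<and> real q\<^sub>2 \<le> N \<and>
       \<bar>of_int a / real q - of_int a\<^sub>1 / real q\<^sub>1 - of_int a\<^sub>2 / real q\<^sub>2\<bar>
         \<le> 1 / (real q * N powr (5/4 - 8 * \<eta>)))"
    unfolding eventually_at_top_linorder by blast
  \<comment> \<open>The 2 covers the error of \<open>a / q\<close> as an approximation to
    \<open>\<alpha>\<close> together with that of the two fractions to \<open>a / q\<close>. The
    other summand makes the claimed bound at least 1 when \<open>N < N\<^sub>0\<close>.\<close>
  define C where "C = 2 + \<bar>N\<^sub>0\<bar> powr (5/2)"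
  have C: "C \<ge> 2" by (simp add: C_def)
  show ?thesis
  proof (intro exI[of _ C] conjI allI impI)
    show "C > 0" using C by simp
    fix N \<alpha> :: real and a q :: int
    assume N: "N \<ge> 3" and q: "1 \<le> q" and qN: "real_of_int q \<le> N powr (5/4)" and cop: "coprime a q"
      and \<alpha>: "\<bar>\<alpha> - real_of_int a / real_of_int q\<bar> \<le> 1 / (real_of_int q * N powr (5/4))"
    let ?D = "real_of_int q * N powr (5/4 - \<epsilon>)"
    have Dpos: "?D > 0" using q N by simp
    show "\<exists>(a\<^sub>1::int) (a\<^sub>2::int) (q\<^sub>1::nat) (q\<^sub>2::nat).
          prime q\<^sub>1 \<and> prime q\<^sub>2 \<and> q\<^sub>1 < q\<^sub>2 \<and> real q\<^sub>2 \<le> N \<and>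
          \<bar>\<alpha> - real_of_int a\<^sub>1 / real q\<^sub>1 - real_of_int a\<^sub>2 / real q\<^sub>2\<bar> \<le> C / ?D"
    proof (cases "N \<ge> N\<^sub>0")
      case True
      have q': "real (nat q) = real_of_int q" "int (nat q) = q" using q by auto
      obtain a\<^sub>1 a\<^sub>2 :: int and q\<^sub>1 q\<^sub>2 :: nat where pr: "prime q\<^sub>1" "prime q\<^sub>2" "q\<^sub>1 < q\<^sub>2" "real q\<^sub>2 \<le> N"
        and le: "\<bar>real_of_int a / real_of_int q - of_int a\<^sub>1 / real q\<^sub>1 - of_int a\<^sub>2 / real q\<^sub>2\<bar>
         \<le> 1 / (real_of_int q * N powr (5/4 - 8 * \<eta>))"
        using N\<^sub>0[OF True, of "nat q" a] q qN cop unfolding q' by auto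
      have mono: "1 / (real_of_int q * N powr s) \<le> 1 / ?D" if "5/4 - \<epsilon> \<le> s" for s
        using Dpos that q N by (intro divide_left_mono mult_left_mono powr_mono) auto
      have "1 / (real_of_int q * N powr (5/4 - 8 * \<eta>)) \<le> 1 / ?D"
        using \<eta>(3) by (intro mono) simp
      moreover have "1 / (real_of_int q * N powr (5/4)) \<le> 1 / ?D"
        using assms by (intro mono) simp
      ultimately have "\<bar>\<alpha> - real_of_int a\<^sub>1 / real q\<^sub>1 - real_of_int a\<^sub>2 / real q\<^sub>2\<bar> \<le> 2 / ?D"
        using \<alpha> le by linarith
      also have "\<dots> \<le> C / ?D" using C Dpos by (intro divide_right_mono) auto
      finally show ?thesis using pr by blast
    next
      case False
      \<comment> \<open>For small \<open>N\<close> the primes 2 and 3 suffice, since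
        \<open>b / 6 = b / 2 - b / 3\<close> and multiples of \<open>1 / 6\<close> come within 1 of
        any real number.\<close>
      define b where "b = round (6 * \<alpha>)"
      have "\<bar>6 * \<alpha> - of_int b\<bar> \<le> 1 / 2"
        unfolding b_def using of_int_round_abs_le[of "6 * \<alpha>"] by (simp add: abs_minus_commute)
      hence "\<bar>\<alpha> - real_of_int b / 6\<bar> \<le> 1" by linarith
      hence "\<bar>\<alpha> - real_of_int b / real 2 - real_of_int (- b) / real 3\<bar> \<le> 1" by simp
      also have "1 \<le> C / ?D"
      proof -
        have "?D \<le> N powr (5/4) * N powr (5/4)"
          using q qN N assms by (intro mult_mono powr_mono) auto
        also have "\<dots> = N powr (5/2)" unfolding powr_add[symmetric] by simp
        also have "\<dots> \<le> \<bar>N\<^sub>0\<bar> powr (5/2)" using False N by (intro powr_mono2) auto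
        also have "\<dots> \<le> C" by (simp add: C_def)
        finally show ?thesis using Dpos by simp
      qed
      finally show ?thesis using N
        by (intro exI[of _ b] exI[of _ "- b"] exI[of _ "2::nat"] exI[of _ "3::nat"]) simp
    qed
  qed
qed

end
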